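(* The generating series $\Psi(\xi,t)=\sum_{\nu\ge0}P_\nu(\xi)t^\nu$ and $\Upsilon(\xi,t)=\sum_{\nu\ge0}Q_\nu(\xi)t^\nu$ are given by \[\Psi(\xi,t)=e^{\xi t+t^2/2},\qquad \Upsilon(\xi,t)=e^{(\xi+t)^2/2}\int_\xi^{\xi+t}e^{-w^2/2}dw=e^{\xi t+t^2/2}\int_0^te^{-\xi w-w^2/2}dw.\] They satisfy \[(\partial_t-\xi)\Psi=t\Psi\qquad\text{and}\qquad(\partial_t-\xi)\Upsilon=t\Upsilon+1.\]
   Context: $P_\nu,Q_\nu\in\mathbb{Q}[\xi]$ ($\nu\in\mathbb{N}$) are the unique polynomials with $P_0=1$, $Q_0=0$ and, for $\nu\ge1$, $P_\nu'=P_{\nu-1}$ and $P_\nu+Q_\nu'-\xi Q_\nu=Q_{\nu-1}$. *)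

theory Defs
  imports "HOL-Complex_Analysis.Complex_Analysis" "HOL-Computational_Algebra.Polynomial"
begin

definition PQ_system :: "(nat \<Rightarrow> rat poly) \<Rightarrow> (nat \<Rightarrow> rat poly) \<Rightarrow> bool" where
  "PQ_system P Q \<longleftrightarrow> P 0 = 1 \<and> Q 0 = 0 \<and>
     (\<forall>\<nu>\<ge>1. pderiv (P \<nu>) = P (\<nu> - 1) \<and>
            P \<nu> + pderiv (Q \<nu>) - [:0, 1:] * Q \<nu> = Q (\<nu> - 1))"

lemma degree_pderiv_minus_X_mult:
  fixes q :: "rat poly"
  assumes "q \<noteq> 0"
  shows "degree (pderiv q - [:0, 1:] * q) = Suc (degree q)"
proof -
  have "degree ([:0, 1:] * q) = Suc (degree q)"
    using assms by simp
  moreover have "degree (pderiv q) < Suc (degree q)"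
    by (simp add: degree_pderiv)
  ultimately show ?thesis
    by (metis degree_add_eq_right degree_minus diff_conv_add_uminus)
qed

lemma ex_antiderivative:
  fixes p :: "rat poly"
  shows "\<exists>r. pderiv r = p"
proof
  define r where "r = (\<Sum>i\<le>degree p. monom (coeff p i / of_nat (Suc i)) (Suc i))"
  have "pderiv r = (\<Sum>i\<le>degree p. monom (coeff p i) i)"
    unfolding r_def higher_pderiv_sum[of 1, simplified]
    by (intro sum.cong refl) (simp add: pderiv_monom del: of_nat_Suc)
  then show "pderiv r = p"
    by (simp add: poly_as_sum_of_monoms)
qed

lemma ex_pderiv_minus_X_mult:
  fixes r :: "rat poly"
  shows "\<exists>q c. pderiv q - [:0, 1:] * q = r + [:c:]"
proof (induction "degree r" arbitrary: r rule: less_induct)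
  case less
  show ?case
  proof (cases "degree r = 0")
    case True
    then obtain a where "r = [:a:]" by (metis degree_eq_zeroE)
    then show ?thesis by (intro exI[of _ 0] exI[of _ "- a"]) simp
  next
    case False
    define n where "n = degree r - 1"
    define m where "m = monom (- lead_coeff r) n"
    define s where "s = r - (pderiv m - [:0, 1:] * m)"
    have n: "degree r = Suc n" using False by (simp add: n_def)
    have "lead_coeff r \<noteq> 0" using False by auto
    then have m: "degree m = n" "m \<noteq> 0"
      by (simp_all add: m_def degree_monom_eq monom_eq_0_iff)
    have "degree (pderiv m - [:0, 1:] * m) = Suc n"
      using degree_pderiv_minus_X_mult[OF m(2)] m by simp
    then have "degree s \<le> Suc n"
      unfolding s_def using n by (metis degree_diff_le order.refl)
    moreover have "coeff s (Suc n) = 0"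
      using m n by (simp add: s_def coeff_pderiv m_def)
    ultimately have "degree s < degree r"
      using n by (metis degree_0 eq_zero_or_degree_less less_Suc_eq_le zero_less_Suc)
    from less[OF this] obtain q c where "pderiv q - [:0, 1:] * q = s + [:c:]" by blast
    then have "pderiv (q + m) - [:0, 1:] * (q + m) = r + [:c:]"
      by (simp add: s_def pderiv_add algebra_simps)
    then show ?thesis by blast
  qed
qed

lemma PQ_step_unique:
  fixes p p' q q' :: "rat poly"
  assumes "pderiv p = pderiv p'"
    and "p + pderiv q - [:0, 1:] * q = p' + pderiv q' - [:0, 1:] * q'"
  shows "p = p' \<and> q = q'"
proof -
  have "pderiv (p' - p) = 0" using assms by (simp add: pderiv_diff)
  then have d: "degree (p' - p) = 0" by (simp add: pderiv_eq_0_iff)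
  have e: "pderiv (q - q') - [:0, 1:] * (q - q') = p' - p"
    using assms(2) unfolding pderiv_diff by algebra
  have "q - q' = 0"
    using degree_pderiv_minus_X_mult[of "q - q'"] d e by force
  then show ?thesis using e by simp
qed

lemma PQ_system_ex1: "\<exists>!PQ. PQ_system (fst PQ) (snd PQ)"
proof -
  have step: "\<exists>y :: rat poly \<times> rat poly. pderiv (fst y) = fst x \<and>
      fst y + pderiv (snd y) - [:0, 1:] * snd y = snd x" for x
  proof -
    obtain r where r: "pderiv r = fst x" using ex_antiderivative by blast
    obtain q c where "pderiv q - [:0, 1:] * q = (snd x - r) + [:c:]"
      using ex_pderiv_minus_X_mult by blast
    then show ?thesis
      using r by (intro exI[of _ "(r - [:c:], q)"]) (simp add: pderiv_diff algebra_simps)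
  qed
  obtain f :: "nat \<Rightarrow> rat poly \<times> rat poly" where f: "f 0 = (1, 0)"
    "\<And>n. pderiv (fst (f (Suc n))) = fst (f n) \<and>
      fst (f (Suc n)) + pderiv (snd (f (Suc n))) - [:0, 1:] * snd (f (Suc n)) = snd (f n)"
    using dependent_nat_choice[where P = "\<lambda>n y. n = 0 \<longrightarrow> y = (1, 0)" and
        Q = "\<lambda>n x y. pderiv (fst y) = fst x \<and>
          fst y + pderiv (snd y) - [:0, 1:] * snd y = (snd x :: rat poly)"] step
    by auto
  have ex: "PQ_system (fst \<circ> f) (snd \<circ> f)"
    unfolding PQ_system_def
  proof (intro conjI allI impI)
    fix \<nu> :: nat assume "1 \<le> \<nu>"
    then obtain n where "\<nu> = Suc n" by (cases \<nu>) auto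
    then show "pderiv ((fst \<circ> f) \<nu>) = (fst \<circ> f) (\<nu> - 1)"
      and "(fst \<circ> f) \<nu> + pderiv ((snd \<circ> f) \<nu>) - [:0, 1:] * (snd \<circ> f) \<nu> = (snd \<circ> f) (\<nu> - 1)"
      using f(2)[of n] by simp_all
  qed (simp_all add: f(1))
  have uniq: "P n = P' n \<and> Q n = Q' n" if "PQ_system P Q" "PQ_system P' Q'" for P Q P' Q' n
  proof (induction n)
    case 0
    then show ?case using that by (simp add: PQ_system_def)
  next
    case (Suc n)
    have "1 \<le> Suc n" "Suc n - 1 = n" by simp_all
    then show ?case
      using that Suc unfolding PQ_system_def by (intro PQ_step_unique) metis+
  qed
  show ?thesis
  proof (rule ex1I[of _ "(fst \<circ> f, snd \<circ> f)"])
    show "PQ_system (fst (fst \<circ> f, snd \<circ> f)) (snd (fst \<circ> f, snd \<circ> f))" using ex by simp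
    fix PQ assume "PQ_system (fst PQ) (snd PQ)"
    then show "PQ = (fst \<circ> f, snd \<circ> f)"
      using uniq[OF _ ex] by (intro prod_eqI ext) auto
  qed
qed

definition PQ_pair :: "(nat \<Rightarrow> rat poly) \<times> (nat \<Rightarrow> rat poly)" where
  "PQ_pair = (THE PQ. PQ_system (fst PQ) (snd PQ))"

definition P_poly :: "nat \<Rightarrow> rat poly" where
  "P_poly = fst PQ_pair"

definition Q_poly :: "nat \<Rightarrow> rat poly" where
  "Q_poly = snd PQ_pair"

lemma PQ_system_P_poly_Q_poly: "PQ_system P_poly Q_poly"
  unfolding P_poly_def Q_poly_def PQ_pair_def by (rule theI'[OF PQ_system_ex1])

definition Psi_term :: "complex \<Rightarrow> complex \<Rightarrow> nat \<Rightarrow> complex" where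
  "Psi_term \<xi> t \<nu> = poly (map_poly of_rat (P_poly \<nu>)) \<xi> * t ^ \<nu>"

definition Upsilon_term :: "complex \<Rightarrow> complex \<Rightarrow> nat \<Rightarrow> complex" where
  "Upsilon_term \<xi> t \<nu> = poly (map_poly of_rat (Q_poly \<nu>)) \<xi> * t ^ \<nu>"

text \<open>Since \<open>suminf\<close> is total, these are the generating series only where the terms are
  summable.\<close>

definition Psi :: "complex \<Rightarrow> complex \<Rightarrow> complex" where
  "Psi \<xi> t = (\<Sum>\<nu>. Psi_term \<xi> t \<nu>)"

definition Upsilon :: "complex \<Rightarrow> complex \<Rightarrow> complex" where
  "Upsilon \<xi> t = (\<Sum>\<nu>. Upsilon_term \<xi> t \<nu>)"

end

theory Submission
  imports Defs
begin

text \<open>Multiplication by \<open>\<xi>\<close> shifts solutions of the defining system: if \<open>z\<^sub>0, z\<^sub>1, z\<^sub>2\<close> are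
  consecutive pairs, then \<open>\<xi> z\<^sub>2 + z\<^sub>1\<close> may follow \<open>z\<^sub>2 + \<xi> z\<^sub>1 + z\<^sub>0\<close>. Since each pair determines
  the next one, induction yields \<open>(n + 1) z\<^sub>n\<^sub>+\<^sub>1 = \<xi> z\<^sub>n + z\<^sub>n\<^sub>-\<^sub>1\<close> for \<open>z\<^sub>n = (P\<^sub>n, Q\<^sub>n)\<close>, where
  \<open>z\<^sub>-\<^sub>1 = (0, 1)\<close>. These are the differential equations of the theorem for formal power series
  in \<open>t\<close>. Such an equation has only one formal solution with a given constant term, so the formal
  series are the Taylor series of the entire solutions given by the closed forms.\<close>

section \<open>The three-term recurrence\<close>

definition PQ_step :: "rat poly \<Rightarrow> rat poly \<Rightarrow> rat poly \<Rightarrow> rat poly \<Rightarrow> bool" where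
  "PQ_step p q p' q' \<longleftrightarrow> pderiv p' = p \<and> p' + pderiv q' - [:0, 1:] * q' = q"

lemma PQ_step_right_unique:
  assumes "PQ_step p q p' q'" and "PQ_step p q p'' q''"
  shows "p' = p'' \<and> q' = q''"
  using assms by (intro PQ_step_unique) (simp_all add: PQ_step_def)

lemma PQ_step_smult:
  assumes "PQ_step p q p' q'"
  shows "PQ_step (smult c p) (smult c q) (smult c p') (smult c q')"
  using assms unfolding PQ_step_def
  by (auto simp: pderiv_smult smult_add_right smult_diff_right)

lemma PQ_step_X_mult_add:
  assumes "PQ_step p\<^sub>0 q\<^sub>0 p\<^sub>1 q\<^sub>1" and "PQ_step p\<^sub>1 q\<^sub>1 p\<^sub>2 q\<^sub>2"
  shows "PQ_step (p\<^sub>2 + ([:0, 1:] * p\<^sub>1 + p\<^sub>0)) (q\<^sub>2 + ([:0, 1:] * q\<^sub>1 + q\<^sub>0))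
    ([:0, 1:] * p\<^sub>2 + p\<^sub>1) ([:0, 1:] * q\<^sub>2 + q\<^sub>1)"
  unfolding PQ_step_def
proof
  have pderiv_X_mult: "pderiv ([:0, 1:] * r + s) = r + [:0, 1:] * pderiv r + pderiv s"
    for r s :: "rat poly"
    by (simp add: pderiv_add pderiv_pCons)
  have p: "p\<^sub>0 = pderiv p\<^sub>1" "p\<^sub>1 = pderiv p\<^sub>2"
    and q: "q\<^sub>0 = p\<^sub>1 + pderiv q\<^sub>1 - [:0, 1:] * q\<^sub>1" "q\<^sub>1 = p\<^sub>2 + pderiv q\<^sub>2 - [:0, 1:] * q\<^sub>2"
    using assms by (simp_all add: PQ_step_def)
  show "pderiv ([:0, 1:] * p\<^sub>2 + p\<^sub>1) = p\<^sub>2 + ([:0, 1:] * p\<^sub>1 + p\<^sub>0)"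
    unfolding pderiv_X_mult using p by simp
  show "[:0, 1:] * p\<^sub>2 + p\<^sub>1 + pderiv ([:0, 1:] * q\<^sub>2 + q\<^sub>1) - [:0, 1:] * ([:0, 1:] * q\<^sub>2 + q\<^sub>1) =
      q\<^sub>2 + ([:0, 1:] * q\<^sub>1 + q\<^sub>0)"
    unfolding pderiv_X_mult using q by algebra
qed

lemma PQ_step_recurrence:
  fixes p q :: "nat \<Rightarrow> rat poly"
  assumes step: "\<And>n. PQ_step (p n) (q n) (p (Suc n)) (q (Suc n))"
    and base: "[:0, 1:] * p 1 + p 0 = 0" "[:0, 1:] * q 1 + q 0 = 0"
  shows "smult (of_nat n) (p (n + 2)) = [:0, 1:] * p (n + 1) + p n \<and>
    smult (of_nat n) (q (n + 2)) = [:0, 1:] * q (n + 1) + q n"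
proof (induction n)
  case 0
  then show ?case using base by simp
next
  case (Suc n)
  have smult_Suc: "smult (of_nat (Suc n)) r = r + smult (of_nat n) r" for r :: "rat poly"
    by (simp add: smult_add_left)
  have raised: "PQ_step (smult (of_nat (Suc n)) (p (n + 2))) (smult (of_nat (Suc n)) (q (n + 2)))
      ([:0, 1:] * p (n + 2) + p (n + 1)) ([:0, 1:] * q (n + 2) + q (n + 1))"
    using PQ_step_X_mult_add[OF step[of n] step[of "Suc n"]] Suc.IH unfolding smult_Suc by simp
  have scaled: "PQ_step (smult (of_nat (Suc n)) (p (n + 2))) (smult (of_nat (Suc n)) (q (n + 2)))
      (smult (of_nat (Suc n)) (p (n + 3))) (smult (of_nat (Suc n)) (q (n + 3)))"
    using PQ_step_smult[OF step[of "n + 2"]] by (simp add: numeral_3_eq_3)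
  from PQ_step_right_unique[OF scaled raised] show ?case
    by (simp add: numeral_2_eq_2 numeral_3_eq_3 del: of_nat_Suc mult_pCons_left)
qed

lemma PQ_system_step:
  assumes "PQ_system P Q"
  shows "PQ_step (P n) (Q n) (P (Suc n)) (Q (Suc n))"
  using assms unfolding PQ_system_def PQ_step_def by (metis diff_Suc_1 le_add1 plus_1_eq_Suc)

lemma PQ_system_recurrence:
  assumes "PQ_system P Q"
  shows "P 1 = [:0, 1:]" and "Q 1 = 1"
    and "smult (of_nat (n + 2)) (P (n + 2)) = [:0, 1:] * P (n + 1) + P n"
    and "smult (of_nat (n + 2)) (Q (n + 2)) = [:0, 1:] * Q (n + 1) + Q n"
proof -
  have init: "P 0 = 1" "Q 0 = 0"
    using assms by (simp_all add: PQ_system_def)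
  \<comment> \<open>Prepending indices \<open>-2\<close> and \<open>-1\<close> makes \<open>0 = 0\<close> the base case of the recurrence.\<close>
  define p where "p = case_nat 0 (case_nat 0 P)"
  define q where "q = case_nat [:0, - 1:] (case_nat 1 Q)"
  have "PQ_step (p n) (q n) (p (Suc n)) (q (Suc n))" for n
    using PQ_system_step[OF assms]
    by (auto simp: p_def q_def init PQ_step_def one_pCons split: nat.split)
  moreover have "[:0, 1:] * p 1 + p 0 = 0" "[:0, 1:] * q 1 + q 0 = 0"
    by (simp_all add: p_def q_def)
  ultimately have rec: "smult (of_nat n) (p (n + 2)) = [:0, 1:] * p (n + 1) + p n \<and>
      smult (of_nat n) (q (n + 2)) = [:0, 1:] * q (n + 1) + q n" for n
    by (rule PQ_step_recurrence)
  show "P 1 = [:0, 1:]" "Q 1 = 1"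
    using rec[of 1] by (simp_all add: p_def q_def init one_pCons)
  show "smult (of_nat (n + 2)) (P (n + 2)) = [:0, 1:] * P (n + 1) + P n"
    "smult (of_nat (n + 2)) (Q (n + 2)) = [:0, 1:] * Q (n + 1) + Q n"
    using rec[of "n + 2"] by (simp_all add: p_def q_def)
qed

section \<open>The generating series as formal power series\<close>

lemma fps_deriv_Abs_fps_eq_linear_iff:
  fixes a :: "nat \<Rightarrow> 'a :: comm_ring_1"
  shows "fps_deriv (Abs_fps a) = (fps_const x + fps_X) * Abs_fps a + fps_const c \<longleftrightarrow>
    a 1 = x * a 0 + c \<and> (\<forall>n. of_nat (n + 2) * a (n + 2) = x * a (n + 1) + a n)"
  (is "?ode \<longleftrightarrow> _")
proof -
  have all_nat_split: "(\<forall>n. R n) \<longleftrightarrow> R 0 \<and> (\<forall>n. R (Suc n))" for R :: "nat \<Rightarrow> bool"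
    by (metis not0_implies_Suc)
  have "?ode \<longleftrightarrow> (\<forall>n. of_nat (n + 1) * a (n + 1) =
      x * a n + (if n = 0 then 0 else a (n - 1)) + (if n = 0 then c else 0))"
    by (simp add: fps_eq_iff distrib_right)
  also have "\<dots> \<longleftrightarrow> a 1 = x * a 0 + c \<and> (\<forall>n. of_nat (n + 2) * a (n + 2) = x * a (n + 1) + a n)"
    by (subst all_nat_split) simp
  finally show ?thesis .
qed

lemma poly_map_poly_of_rat_recurrence:
  fixes x :: "'a :: field_char_0"
  assumes "smult c r = [:0, 1:] * s + u"
  shows "of_rat c * poly (map_poly of_rat r) x =
    x * poly (map_poly of_rat s) x + poly (map_poly of_rat u) x"
proof -
  have "map_poly of_rat (smult c r) = (map_poly of_rat (pCons 0 s + u) :: 'a poly)"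
    using assms by simp
  then have "smult (of_rat c) (map_poly of_rat r) =
      pCons 0 (map_poly of_rat s) + (map_poly of_rat u :: 'a poly)"
    by (simp add: poly_eq_iff coeff_map_poly of_rat_mult of_rat_add coeff_pCons split: nat.splits)
  from arg_cong[OF this, of "\<lambda>p. poly p x"] show ?thesis by simp
qed

definition Psi_fps :: "complex \<Rightarrow> complex fps" where
  "Psi_fps \<xi> = Abs_fps (\<lambda>\<nu>. poly (map_poly of_rat (P_poly \<nu>)) \<xi>)"

definition Upsilon_fps :: "complex \<Rightarrow> complex fps" where
  "Upsilon_fps \<xi> = Abs_fps (\<lambda>\<nu>. poly (map_poly of_rat (Q_poly \<nu>)) \<xi>)"

lemma Psi_term_eq: "Psi_term \<xi> t = (\<lambda>n. fps_nth (Psi_fps \<xi>) n * t ^ n)"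
  by (simp add: fun_eq_iff Psi_term_def Psi_fps_def)

lemma Upsilon_term_eq: "Upsilon_term \<xi> t = (\<lambda>n. fps_nth (Upsilon_fps \<xi>) n * t ^ n)"
  by (simp add: fun_eq_iff Upsilon_term_def Upsilon_fps_def)

lemma Psi_fps_nth_0: "fps_nth (Psi_fps \<xi>) 0 = 1"
  using PQ_system_P_poly_Q_poly by (simp add: Psi_fps_def PQ_system_def)

lemma Upsilon_fps_nth_0: "fps_nth (Upsilon_fps \<xi>) 0 = 0"
  using PQ_system_P_poly_Q_poly by (simp add: Upsilon_fps_def PQ_system_def)

lemma fps_deriv_Psi_fps: "fps_deriv (Psi_fps \<xi>) = (fps_const \<xi> + fps_X) * Psi_fps \<xi>"
proof -
  note PQ = PQ_system_P_poly_Q_poly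
  note rec = PQ_system_recurrence[OF PQ]
  have "fps_deriv (Psi_fps \<xi>) = (fps_const \<xi> + fps_X) * Psi_fps \<xi> + fps_const 0"
    unfolding Psi_fps_def fps_deriv_Abs_fps_eq_linear_iff
    using PQ rec(1)
      poly_map_poly_of_rat_recurrence[OF rec(3), of _ \<xi>, unfolded of_rat_of_nat_eq]
    by (simp add: PQ_system_def map_poly_pCons)
  then show ?thesis by simp
qed

lemma fps_deriv_Upsilon_fps:
  "fps_deriv (Upsilon_fps \<xi>) = (fps_const \<xi> + fps_X) * Upsilon_fps \<xi> + 1"
proof -
  note PQ = PQ_system_P_poly_Q_poly
  note rec = PQ_system_recurrence[OF PQ]
  have "fps_deriv (Upsilon_fps \<xi>) = (fps_const \<xi> + fps_X) * Upsilon_fps \<xi> + fps_const 1"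
    unfolding Upsilon_fps_def fps_deriv_Abs_fps_eq_linear_iff
    using PQ rec(2)
      poly_map_poly_of_rat_recurrence[OF rec(4), of _ \<xi>, unfolded of_rat_of_nat_eq]
    by (simp add: PQ_system_def)
  then show ?thesis by simp
qed

section \<open>First-order linear differential equations\<close>

lemma fps_linear_ode_unique:
  fixes F\<^sub>1 F\<^sub>2 :: "'a :: {idom, ring_char_0} fps"
  assumes "fps_deriv F\<^sub>1 = G * F\<^sub>1 + H" and "fps_deriv F\<^sub>2 = G * F\<^sub>2 + H"
    and "fps_nth F\<^sub>1 0 = fps_nth F\<^sub>2 0"
  shows "F\<^sub>1 = F\<^sub>2"
proof -
  define D where "D = F\<^sub>1 - F\<^sub>2"
  have deriv_D: "fps_deriv D = G * D"
    using assms by (simp add: D_def algebra_simps)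
  have "fps_nth D n = 0" for n
  proof (induction n rule: less_induct)
    case (less n)
    show ?case
    proof (cases n)
      case 0
      then show ?thesis using assms(3) by (simp add: D_def)
    next
      case (Suc m)
      have "of_nat (Suc m) * fps_nth D (Suc m) = fps_nth (G * D) m"
        using arg_cong[OF deriv_D, of "\<lambda>F. fps_nth F m"] by simp
      also have "\<dots> = 0"
        using less Suc by (simp add: fps_mult_nth)
      finally show ?thesis
        using Suc by (simp del: of_nat_Suc)
    qed
  qed
  then have "D = 0" by (simp add: fps_eq_iff)
  then show ?thesis by (simp add: D_def)
qed

lemma linear_ode_fps_sums:
  fixes f g h :: "complex \<Rightarrow> complex"
  assumes f: "\<And>z. ereal (norm z) < r \<Longrightarrow> (f has_field_derivative g z * f z + h z) (at z)"
    and G: "g has_fps_expansion G" and H: "h has_fps_expansion H"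
    and F: "fps_deriv F = G * F + H" "fps_nth F 0 = f 0"
    and z: "ereal (norm z) < r"
  shows "(\<lambda>n. fps_nth F n * z ^ n) sums f z"
proof -
  have "0 \<le> ereal (norm z)" by simp
  then have "0 < r" using z by (rule order.strict_trans1)
  then have ball: "open (eball 0 r :: complex set)" "(0 :: complex) \<in> eball 0 r"
    by (simp_all add: zero_ereal_def)
  have holo: "f holomorphic_on eball 0 r"
    unfolding holomorphic_on_open[OF ball(1)] by (intro ballI exI, rule f) simp
  then have expansion: "f has_fps_expansion fps_expansion f 0"
    using ball by (intro has_fps_expansion_fps_expansion)
  have "eventually (\<lambda>z. deriv f z = g z * f z + h z) (nhds 0)"
    using eventually_nhds_in_open[OF ball] by eventually_elim (auto intro: DERIV_imp_deriv f)
  then have "(\<lambda>z. g z * f z + h z) has_fps_expansion fps_deriv (fps_expansion f 0)"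
    using has_fps_expansion_deriv[OF expansion] by (simp add: has_fps_expansion_cong)
  moreover have "(\<lambda>z. g z * f z + h z) has_fps_expansion G * fps_expansion f 0 + H"
    by (intro fps_expansion_intros G H expansion)
  ultimately have ode: "fps_deriv (fps_expansion f 0) = G * fps_expansion f 0 + H"
    using fps_expansion_unique_complex by blast
  have "fps_expansion f 0 = F"
    by (rule fps_linear_ode_unique[OF ode F(1)]) (simp add: F(2) fps_expansion_def)
  then show ?thesis
    using has_fps_expansion_imp_sums_complex[OF expansion holo z] by simp
qed

lemma has_field_derivative_contour_integral_linepath:
  assumes "f holomorphic_on S" and "open S" "convex S" and "a \<in> S" "z \<in> S"
  shows "((\<lambda>z. contour_integral (linepath a z) f) has_field_derivative f z) (at z)"
proof -
  obtain F where F: "\<And>z. z \<in> S \<Longrightarrow> (F has_field_derivative f z) (at z within S)"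
    using holomorphic_convex_primitive'[OF assms(3,2,1)] by blast
  have integral_eq: "F y - F a = contour_integral (linepath a y) f" if "y \<in> S" for y
  proof -
    have "path_image (linepath a y) \<subseteq> S"
      using assms that by (simp add: closed_segment_subset)
    from contour_integral_primitive[OF F valid_path_linepath this] show ?thesis
      by (simp add: contour_integral_unique)
  qed
  have "(F has_field_derivative f z) (at z)"
    using F[OF \<open>z \<in> S\<close>] by (simp add: at_within_open[OF \<open>z \<in> S\<close> \<open>open S\<close>])
  from DERIV_diff[OF this DERIV_const] have "((\<lambda>y. F y - F a) has_field_derivative f z) (at z)"
    by simp
  from this \<open>open S\<close> \<open>z \<in> S\<close> integral_eq show ?thesis
    by (rule has_field_derivative_transform_within_open)
qed

lemma has_field_derivative_variation_of_constants:
  assumes A: "\<And>z. z \<in> S \<Longrightarrow> (A has_field_derivative a z) (at z)"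
    and h: "h holomorphic_on S" and S: "open S" "convex S" "z\<^sub>0 \<in> S" "z \<in> S"
  defines "f \<equiv> \<lambda>z. exp (A z) * contour_integral (linepath z\<^sub>0 z) (\<lambda>w. exp (- A w) * h w)"
  shows "(f has_field_derivative a z * f z + h z) (at z)"
proof -
  have "A holomorphic_on S"
    using A S(1) by (auto simp: holomorphic_on_open)
  then have "(\<lambda>w. exp (- A w) * h w) holomorphic_on S"
    by (intro holomorphic_intros h)
  then have deriv_integral: "((\<lambda>z. contour_integral (linepath z\<^sub>0 z) (\<lambda>w. exp (- A w) * h w))
      has_field_derivative exp (- A z) * h z) (at z)"
    using S by (rule has_field_derivative_contour_integral_linepath)
  have deriv_exp: "((\<lambda>z. exp (A z)) has_field_derivative exp (A z) * a z) (at z)"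
    by (rule DERIV_chain2[OF DERIV_exp A[OF \<open>z \<in> S\<close>]])
  show ?thesis
    unfolding f_def
    by (rule DERIV_cong[OF DERIV_mult[OF deriv_exp deriv_integral]])
      (simp add: exp_minus field_simps)
qed

section \<open>Closed forms of the generating series\<close>

lemma has_field_derivative_exp_quadratic:
  fixes \<xi> z :: complex
  shows "((\<lambda>z. exp (\<xi> * z + z\<^sup>2 / 2)) has_field_derivative (\<xi> + z) * exp (\<xi> * z + z\<^sup>2 / 2)) (at z)"
  by (auto intro!: derivative_eq_intros)

lemma has_field_derivative_exp_quadratic_mult_integral:
  fixes \<xi> z :: complex
  defines "f \<equiv> \<lambda>z. exp (\<xi> * z + z\<^sup>2 / 2) *
    contour_integral (linepath 0 z) (\<lambda>w. exp (- \<xi> * w - w\<^sup>2 / 2))"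
  shows "(f has_field_derivative (\<xi> + z) * f z + 1) (at z)"
proof -
  have "((\<lambda>z. \<xi> * z + z\<^sup>2 / 2) has_field_derivative \<xi> + z) (at z)" for z
    by (auto intro!: derivative_eq_intros)
  from has_field_derivative_variation_of_constants
    [OF this, where S = UNIV and h = "\<lambda>_. 1" and z\<^sub>0 = 0]
  show ?thesis by (simp add: f_def)
qed

lemma Psi_term_sums: "Psi_term \<xi> t sums exp (\<xi> * t + t\<^sup>2 / 2)"
  unfolding Psi_term_eq
proof (rule linear_ode_fps_sums[where r = \<infinity>])
  show "((\<lambda>z. exp (\<xi> * z + z\<^sup>2 / 2)) has_field_derivative
      (\<xi> + z) * exp (\<xi> * z + z\<^sup>2 / 2) + 0) (at z)" for z
    using has_field_derivative_exp_quadratic by simp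
  show "fps_deriv (Psi_fps \<xi>) = (fps_const \<xi> + fps_X) * Psi_fps \<xi> + 0"
    by (simp add: fps_deriv_Psi_fps)
  show "(\<lambda>z. \<xi> + z) has_fps_expansion fps_const \<xi> + fps_X"
    by (intro fps_expansion_intros)
qed (simp_all add: Psi_fps_nth_0)

lemma Upsilon_term_sums:
  "Upsilon_term \<xi> t sums
    (exp (\<xi> * t + t\<^sup>2 / 2) * contour_integral (linepath 0 t) (\<lambda>w. exp (- \<xi> * w - w\<^sup>2 / 2)))"
  (is "_ sums ?f t")
  unfolding Upsilon_term_eq
proof (rule linear_ode_fps_sums[where r = \<infinity>])
  show "(?f has_field_derivative (\<xi> + z) * ?f z + 1) (at z)" for z
    by (rule has_field_derivative_exp_quadratic_mult_integral)
  show "fps_deriv (Upsilon_fps \<xi>) = (fps_const \<xi> + fps_X) * Upsilon_fps \<xi> + 1"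
    by (rule fps_deriv_Upsilon_fps)
  show "fps_nth (Upsilon_fps \<xi>) 0 = ?f 0"
    unfolding contour_integral_trivial by (simp add: Upsilon_fps_nth_0)
  show "(\<lambda>z. \<xi> + z) has_fps_expansion fps_const \<xi> + fps_X"
    by (intro fps_expansion_intros)
qed simp_all

lemma Psi_eq: "Psi \<xi> = (\<lambda>t. exp (\<xi> * t + t\<^sup>2 / 2))"
  using Psi_term_sums by (auto simp: Psi_def sums_iff)

lemma Upsilon_eq:
  "Upsilon \<xi> = (\<lambda>t. exp (\<xi> * t + t\<^sup>2 / 2) *
    contour_integral (linepath 0 t) (\<lambda>w. exp (- \<xi> * w - w\<^sup>2 / 2)))"
  using Upsilon_term_sums by (auto simp: Upsilon_def sums_iff)

lemma has_field_derivative_Psi: "(Psi \<xi> has_field_derivative (\<xi> + t) * Psi \<xi> t) (at t)"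
  unfolding Psi_eq by (rule has_field_derivative_exp_quadratic)

lemma has_field_derivative_Upsilon:
  "(Upsilon \<xi> has_field_derivative (\<xi> + t) * Upsilon \<xi> t + 1) (at t)"
  unfolding Upsilon_eq by (rule has_field_derivative_exp_quadratic_mult_integral)

lemma contour_integral_gaussian_translate:
  "exp ((\<xi> + t)\<^sup>2 / 2) * contour_integral (linepath \<xi> (\<xi> + t)) (\<lambda>w. exp (- (w\<^sup>2 / 2))) =
    exp (\<xi> * t + t\<^sup>2 / 2) * contour_integral (linepath 0 t) (\<lambda>w. exp (- \<xi> * w - w\<^sup>2 / 2))"
  (is "_ * ?I = _ * ?J")
proof -
  have "?I = contour_integral (linepath 0 t) (\<lambda>w. exp (- ((w + \<xi>)\<^sup>2 / 2)))"
    using contour_integral_translate[of \<xi> "linepath 0 t"]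
    by (simp add: linepath_translate add.commute)
  also have "(\<lambda>w. exp (- ((w + \<xi>)\<^sup>2 / 2))) = (\<lambda>w. exp (- (\<xi>\<^sup>2 / 2)) * exp (- \<xi> * w - w\<^sup>2 / 2))"
    by (simp add: exp_add[symmetric] power2_eq_square add_divide_distrib algebra_simps)
  also have "contour_integral (linepath 0 t) \<dots> = exp (- (\<xi>\<^sup>2 / 2)) * ?J"
    by (intro contour_integral_lmul contour_integrable_continuous_linepath continuous_intros) simp
  finally have "?I = exp (- (\<xi>\<^sup>2 / 2)) * ?J" .
  moreover have "(\<xi> + t)\<^sup>2 / 2 + - (\<xi>\<^sup>2 / 2) = \<xi> * t + t\<^sup>2 / 2"
    by (simp add: power2_eq_square field_simps)
  then have "exp ((\<xi> + t)\<^sup>2 / 2) * exp (- (\<xi>\<^sup>2 / 2)) = exp (\<xi> * t + t\<^sup>2 / 2)"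
    by (simp only: exp_add[symmetric])
  ultimately show ?thesis
    by (simp only: mult.assoc[symmetric])
qed

theorem theorem3p4:
  fixes \<xi> t :: complex
  shows "summable (Psi_term \<xi> t) \<and>
     summable (Upsilon_term \<xi> t) \<and>
     Psi \<xi> t = exp (\<xi> * t + t\<^sup>2 / 2) \<and>
     Upsilon \<xi> t =
      exp ((\<xi> + t)\<^sup>2 / 2) * contour_integral (linepath \<xi> (\<xi> + t)) (\<lambda>w. exp (- (w\<^sup>2 / 2))) \<and>
     Upsilon \<xi> t =
      exp (\<xi> * t + t\<^sup>2 / 2) * contour_integral (linepath 0 t) (\<lambda>w. exp (- \<xi> * w - w\<^sup>2 / 2)) \<and>
     Psi \<xi> field_differentiable (at t) \<and>
     deriv (Psi \<xi>) t - \<xi> * Psi \<xi> t = t * Psi \<xi> t \<and>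
     Upsilon \<xi> field_differentiable (at t) \<and>
     deriv (Upsilon \<xi>) t - \<xi> * Upsilon \<xi> t = t * Upsilon \<xi> t + 1"
proof (intro conjI)
  show "summable (Psi_term \<xi> t)" "summable (Upsilon_term \<xi> t)"
    using Psi_term_sums Upsilon_term_sums by (blast intro: sums_summable)+
  show "Psi \<xi> t = exp (\<xi> * t + t\<^sup>2 / 2)"
    and Upsilon: "Upsilon \<xi> t =
      exp (\<xi> * t + t\<^sup>2 / 2) * contour_integral (linepath 0 t) (\<lambda>w. exp (- \<xi> * w - w\<^sup>2 / 2))"
    by (simp_all only: Psi_eq Upsilon_eq)
  show "Upsilon \<xi> t =
      exp ((\<xi> + t)\<^sup>2 / 2) * contour_integral (linepath \<xi> (\<xi> + t)) (\<lambda>w. exp (- (w\<^sup>2 / 2)))"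
    using Upsilon contour_integral_gaussian_translate by simp
  show "Psi \<xi> field_differentiable (at t)" "Upsilon \<xi> field_differentiable (at t)"
    using has_field_derivative_Psi has_field_derivative_Upsilon
    unfolding field_differentiable_def by blast+
  show "deriv (Psi \<xi>) t - \<xi> * Psi \<xi> t = t * Psi \<xi> t"
    "deriv (Upsilon \<xi>) t - \<xi> * Upsilon \<xi> t = t * Upsilon \<xi> t + 1"
    using DERIV_imp_deriv[OF has_field_derivative_Psi]
      DERIV_imp_deriv[OF has_field_derivative_Upsilon]
    by (simp_all add: algebra_simps)
qed

end
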